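(* Let $q(n)$ denote the number of maximal independent sets of the ortho-hexagonal cactus $Q(n)$. Then $q(1)=5$, $q(2)=19$, $q(3)=72$, and $q(n)=3q(n-1)+3q(n-2)$ for all $n\ge 4$.
   Context: For $n\ge 1$, the ortho-hexagonal cactus $Q(n)$ is the graph formed by a chain of $n$ 6-cycles $B_1,\dots,B_n$, where for each $1\le i\le n-1$ the consecutive cycles $B_i$ and $B_{i+1}$ share exactly one vertex, non-consecutive cycles share no vertex, every vertex lies in at most two cycles, and for each $2\le i\le n-1$ the two shared (cut) vertices of $B_i$ are adjacent. An independent set is maximal if no further vertex can be added while keeping it independent. *)

theory Defs
  imports Main
begin

record 'a graph =
  verts :: "'a set"
  edges :: "'a set set"

definition cycle_graph :: "nat \<Rightarrow> 'a graph \<Rightarrow> bool" where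
  "cycle_graph k C \<longleftrightarrow> k \<ge> 3 \<and>
     (\<exists>c. inj_on c {..<k} \<and>
          verts C = c ` {..<k} \<and>
          edges C = (\<lambda>j. {c j, c (Suc j mod k)}) ` {..<k})"

definition ortho_hexagonal_cactus :: "nat \<Rightarrow> 'a graph \<Rightarrow> bool" where
  "ortho_hexagonal_cactus n G \<longleftrightarrow> n \<ge> 1 \<and>
     (\<exists>B :: nat \<Rightarrow> 'a graph.
        (\<forall>i\<in>{1..n}. cycle_graph 6 (B i)) \<and>
        verts G = (\<Union>i\<in>{1..n}. verts (B i)) \<and>
        edges G = (\<Union>i\<in>{1..n}. edges (B i)) \<and>
        (\<forall>i\<in>{1..n}. i + 1 \<le> n \<longrightarrow> card (verts (B i) \<inter> verts (B (i + 1))) = 1) \<and>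
        (\<forall>i\<in>{1..n}. \<forall>j\<in>{1..n}. i + 1 < j \<longrightarrow> verts (B i) \<inter> verts (B j) = {}) \<and>
        (\<forall>v\<in>verts G. card {i\<in>{1..n}. v \<in> verts (B i)} \<le> 2) \<and>
        (\<forall>i\<in>{1..n}. 2 \<le> i \<and> i + 1 \<le> n \<longrightarrow>
           (\<forall>u\<in>verts (B (i - 1)) \<inter> verts (B i). \<forall>w\<in>verts (B i) \<inter> verts (B (i + 1)).
              {u, w} \<in> edges G)))"

definition independent_set :: "'a graph \<Rightarrow> 'a set \<Rightarrow> bool" where
  "independent_set G S \<longleftrightarrow> S \<subseteq> verts G \<and> (\<forall>u\<in>S. \<forall>v\<in>S. {u, v} \<notin> edges G)"

definition maximal_independent_set :: "'a graph \<Rightarrow> 'a set \<Rightarrow> bool" where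
  "maximal_independent_set G S \<longleftrightarrow> independent_set G S \<and>
     (\<forall>v\<in>verts G - S. \<not> independent_set G (insert v S))"

text \<open>
  Such graphs exist for every \<open>n \<ge> 1\<close>: let the \<open>i\<close>-th hexagon have vertices
  \<open>5 (i - 1), \<dots>, 5 i\<close> in cyclic order.
\<close>

lemma ortho_hexagonal_cactus_exists:
  assumes "n \<ge> 1"
  shows "\<exists>G :: nat graph. ortho_hexagonal_cactus n G"
proof -
  define B :: "nat \<Rightarrow> nat graph" where
    "B = (\<lambda>i. \<lparr>verts = (\<lambda>j. 5 * (i - 1) + j) ` {..<6},
               edges = (\<lambda>j. {5 * (i - 1) + j, 5 * (i - 1) + Suc j mod 6}) ` {..<6}\<rparr>)"
  define G :: "nat graph" where
    "G = \<lparr>verts = (\<Union>i\<in>{1..n}. verts (B i)), edges = (\<Union>i\<in>{1..n}. edges (B i))\<rparr>"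
  have vB: "verts (B i) = {5 * (i - 1)..5 * (i - 1) + 5}" for i
  proof -
    have "(\<lambda>j. 5 * (i - 1) + j) ` {..<6} = (\<lambda>j. 5 * (i - 1) + j) ` {0..5}"
      by (rule arg_cong[where f = "image _"]) auto
    then show ?thesis
      unfolding B_def by (simp add: image_add_atLeastAtMost add.commute)
  qed
  have meet: "verts (B i) \<inter> verts (B (i + 1)) = {5 * i}" if "i \<ge> 1" for i
    using that unfolding vB by auto
  have cyc: "cycle_graph 6 (B i)" for i
    unfolding cycle_graph_def B_def
    by (intro conjI exI[of _ "\<lambda>j. 5 * (i - 1) + j"]) (auto simp: inj_on_def)
  have two: "card {i \<in> {1..n}. v \<in> verts (B i)} \<le> 2" for v
  proof -
    have "{i \<in> {1..n}. v \<in> verts (B i)} \<subseteq> {v div 5, v div 5 + 1}"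
      unfolding vB by auto
    then have "card {i \<in> {1..n}. v \<in> verts (B i)} \<le> card {v div 5, v div 5 + 1}"
      by (intro card_mono) auto
    then show ?thesis by simp
  qed
  have adj: "{5 * (i - 1), 5 * i} \<in> edges G" if "i \<in> {1..n}" for i
  proof -
    have "{5 * (i - 1) + 5, 5 * (i - 1) + Suc 5 mod 6} \<in> edges (B i)"
      unfolding B_def by force
    moreover have "5 * (i - 1) + 5 = 5 * i" using that by auto
    ultimately have "{5 * (i - 1), 5 * i} \<in> edges (B i)"
      by (simp add: insert_commute)
    then show ?thesis using that unfolding G_def by auto
  qed
  have "{u, w} \<in> edges G"
    if "i \<in> {1..n}" "2 \<le> i"
      "u \<in> verts (B (i - 1)) \<inter> verts (B i)" "w \<in> verts (B i) \<inter> verts (B (i + 1))" for i u w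
    using meet[of "i - 1"] meet[of i] adj[of i] that by simp
  moreover have "verts (B i) \<inter> verts (B j) = {}" if "1 \<le> i" "i + 1 < j" for i j
    using that unfolding vB by auto
  ultimately have "ortho_hexagonal_cactus n G"
    unfolding ortho_hexagonal_cactus_def
    using assms cyc two meet
    by (intro conjI exI[of _ B]) (auto simp: G_def simp del: One_nat_def)
  then show ?thesis by blast
qed

end

theory Submission
  imports Defs
begin

text \<open>
  Process the chain one hexagon at a time, always leaving through a vertex adjacent to the
  entry vertex. An independent set of the part built so far that dominates everything except
  possibly the exit vertex is in one of three states: it contains the exit vertex, it
  dominates it from outside, or it leaves it undominated. If these states are counted by
  \<open>A\<close>, \<open>D\<close> and \<open>U\<close>, then attaching a hexagon gives \<open>A' = 2 D + 2 U\<close>,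
  \<open>D' = 2 A + 2 D + U\<close> and \<open>U' = D + U\<close>. A single vertex has \<open>(A, D, U) = (1, 0, 1)\<close>,
  and the maximal independent sets number \<open>A + D\<close>. As \<open>A = 2 U\<close> after the first step, the
  recursion acts on \<open>(D, U)\<close> by a matrix of trace 3 and determinant -3.
\<close>

definition hexagon :: "'a graph \<Rightarrow> 'a \<Rightarrow> 'a \<Rightarrow> 'a \<Rightarrow> 'a \<Rightarrow> 'a \<Rightarrow> 'a \<Rightarrow> bool" where
  "hexagon H v a b c d w \<longleftrightarrow> distinct [v, a, b, c, d, w] \<and>
     verts H = {v, a, b, c, d, w} \<and>
     edges H = {{v, a}, {a, b}, {b, c}, {c, d}, {d, w}, {w, v}}"

lemma cycle_graph_6_hexagon:
  assumes "cycle_graph 6 H"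
  obtains v a b c d w where "hexagon H v a b c d w"
proof -
  obtain f where f: "inj_on f {..<6::nat}" "verts H = f ` {..<6}"
    "edges H = (\<lambda>j. {f j, f (Suc j mod 6)}) ` {..<6}"
    using assms unfolding cycle_graph_def by blast
  have six: "{..<6::nat} = {0, 1, 2, 3, 4, 5}" by auto
  have "hexagon H (f 0) (f 1) (f 2) (f 3) (f 4) (f 5)"
    unfolding hexagon_def f(2,3) six using f(1)[THEN inj_on_eq_iff] by (simp flip: numeral_2_eq_2)
  then show ?thesis by (rule that)
qed

lemma hexagon_rotate: "hexagon H v a b c d w \<Longrightarrow> hexagon H a b c d w v"
  unfolding hexagon_def by auto

lemma hexagon_rotations:
  assumes "hexagon H v a b c d w"
  shows "hexagon H v a b c d w" "hexagon H a b c d w v" "hexagon H b c d w v a"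
    "hexagon H c d w v a b" "hexagon H d w v a b c" "hexagon H w v a b c d"
  using assms by (auto intro!: hexagon_rotate)

lemma hexagon_reflect: "hexagon H v a b c d w \<Longrightarrow> hexagon H w d c b a v"
  unfolding hexagon_def by (auto simp: insert_commute)

lemma hexagon_closing_edge:
  assumes "hexagon H v a b c d w" and "{x, y} \<in> edges H"
  obtains a' b' c' d' where "hexagon H x a' b' c' d' y"
proof -
  note s = hexagon_rotations[OF assms(1)] and t = hexagon_rotations[OF assms(1), THEN hexagon_reflect]
  have "{x, y} \<in> {{v, a}, {a, b}, {b, c}, {c, d}, {d, w}, {w, v}}"
    using assms unfolding hexagon_def by simp
  then have "\<exists>a' b' c' d'. hexagon H x a' b' c' d' y"
    unfolding insert_iff doubleton_eq_iff using s t by blast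
  then show ?thesis using that by blast
qed

lemma cycle_graph_6_closing_edge:
  assumes "cycle_graph 6 H" and "{x, y} \<in> edges H"
  obtains a b c d where "hexagon H x a b c d y"
  using assms by (metis cycle_graph_6_hexagon hexagon_closing_edge)

lemma cycle_graph_6_neighbour:
  assumes "cycle_graph 6 H" and "x \<in> verts H"
  obtains y where "y \<in> verts H" "{x, y} \<in> edges H"
proof -
  obtain v a b c d w where H: "hexagon H v a b c d w"
    using assms(1) by (rule cycle_graph_6_hexagon)
  then have "x \<in> {v, a, b, c, d, w}"
    using assms(2) unfolding hexagon_def by simp
  then obtain a' b' c' d' y where "hexagon H x a' b' c' d' y"
    unfolding insert_iff empty_iff using hexagon_rotations[OF H] by blast
  then show ?thesis
    unfolding hexagon_def by (intro that[of y]) (simp_all add: insert_commute)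
qed

definition dominated :: "'a graph \<Rightarrow> 'a set \<Rightarrow> 'a \<Rightarrow> bool" where
  "dominated G S x \<longleftrightarrow> (\<exists>y\<in>S. {x, y} \<in> edges G)"

definition dominating_except :: "'a graph \<Rightarrow> 'a \<Rightarrow> 'a set \<Rightarrow> bool" where
  "dominating_except G v S \<longleftrightarrow>
     independent_set G S \<and> (\<forall>x\<in>verts G - S - {v}. dominated G S x)"

definition containing_sets :: "'a graph \<Rightarrow> 'a \<Rightarrow> 'a set set" where
  "containing_sets G v = {S. dominating_except G v S \<and> v \<in> S}"

definition dominating_sets :: "'a graph \<Rightarrow> 'a \<Rightarrow> 'a set set" where
  "dominating_sets G v = {S. dominating_except G v S \<and> v \<notin> S \<and> dominated G S v}"

definition missing_sets :: "'a graph \<Rightarrow> 'a \<Rightarrow> 'a set set" where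
  "missing_sets G v = {S. dominating_except G v S \<and> v \<notin> S \<and> \<not> dominated G S v}"

lemmas state_sets_defs = containing_sets_def dominating_sets_def missing_sets_def

definition rooted_graph :: "'a graph \<Rightarrow> 'a \<Rightarrow> bool" where
  "rooted_graph G v \<longleftrightarrow> finite (verts G) \<and> v \<in> verts G \<and>
     edges G \<subseteq> Pow (verts G) \<and> (\<forall>x. {x} \<notin> edges G)"

lemma maximal_independent_sets_eq:
  assumes "rooted_graph G v"
  shows "{S. maximal_independent_set G S} = containing_sets G v \<union> dominating_sets G v"
proof -
  have loop: "{x} \<notin> edges G" for x
    using assms unfolding rooted_graph_def by blast
  have ins: "independent_set G (insert x S) \<longleftrightarrow> \<not> dominated G S x"
    if "independent_set G S" "x \<in> verts G" for S x
    using that loop unfolding independent_set_def dominated_def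
    by (auto simp: insert_commute)
  have "maximal_independent_set G S \<longleftrightarrow>
      independent_set G S \<and> (\<forall>x\<in>verts G - S. dominated G S x)" for S
    unfolding maximal_independent_set_def using ins by blast
  moreover have "v \<in> verts G"
    using assms unfolding rooted_graph_def by blast
  ultimately show ?thesis
    unfolding containing_sets_def dominating_sets_def dominating_except_def by blast
qed

lemma state_sets_subset:
  "containing_sets K x \<subseteq> Pow (verts K)" "dominating_sets K x \<subseteq> Pow (verts K)"
  "missing_sets K x \<subseteq> Pow (verts K)"
  unfolding state_sets_defs dominating_except_def independent_set_def by blast+

lemma finite_state_sets:
  assumes "rooted_graph G v"
  shows "finite (containing_sets G v)" "finite (dominating_sets G v)" "finite (missing_sets G v)"
  using assms state_sets_subset[of G v] unfolding rooted_graph_def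
  by (meson finite_Pow_iff finite_subset)+

lemma card_maximal_independent_sets:
  assumes "rooted_graph G v"
  shows "card {S. maximal_independent_set G S} =
    card (containing_sets G v) + card (dominating_sets G v)"
  unfolding maximal_independent_sets_eq[OF assms]
  using finite_state_sets[OF assms]
  by (intro card_Un_disjoint) (auto simp: state_sets_defs)

definition graph_union :: "'a graph \<Rightarrow> 'a graph \<Rightarrow> 'a graph" where
  "graph_union G H = \<lparr>verts = verts G \<union> verts H, edges = edges G \<union> edges H\<rparr>"

lemma verts_graph_union [simp]: "verts (graph_union G H) = verts G \<union> verts H"
  and edges_graph_union [simp]: "edges (graph_union G H) = edges G \<union> edges H"
  unfolding graph_union_def by simp_all

locale hexagon_attachment =
  fixes G H :: "'a graph" and v a b c d w :: 'a
  assumes rooted: "rooted_graph G v"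
    and hex: "hexagon H v a b c d w"
    and meet: "verts G \<inter> verts H = {v}"
begin

abbreviation GH :: "'a graph" where "GH \<equiv> graph_union G H"

lemma distinct_hex: "distinct [v, a, b, c, d, w]"
  using hex unfolding hexagon_def by (elim conjE)

lemma verts_H: "verts H = {v, a, b, c, d, w}"
  using hex unfolding hexagon_def by (elim conjE)

lemma edges_H: "edges H = {{v, a}, {a, b}, {b, c}, {c, d}, {d, w}, {w, v}}"
  using hex unfolding hexagon_def by (elim conjE)

lemma new_vertices: "a \<notin> verts G" "b \<notin> verts G" "c \<notin> verts G" "d \<notin> verts G" "w \<notin> verts G"
  using meet distinct_hex unfolding verts_H by auto

lemma root_in: "v \<in> verts G"
  using rooted unfolding rooted_graph_def by blast

lemma edge_in_verts: "{x, y} \<in> edges G \<Longrightarrow> x \<in> verts G \<and> y \<in> verts G"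
  using rooted unfolding rooted_graph_def by blast

lemma rooted_union: "rooted_graph GH w"
  using rooted distinct_hex unfolding rooted_graph_def
  by (auto simp: verts_H edges_H)

lemma edges_old: "x \<in> verts G \<Longrightarrow> x \<noteq> v \<Longrightarrow> {x, y} \<in> edges GH \<longleftrightarrow> {x, y} \<in> edges G"
  using new_vertices by (auto simp: edges_H doubleton_eq_iff)

lemma edges_new:
  "{v, y} \<in> edges GH \<longleftrightarrow> {v, y} \<in> edges G \<or> y = a \<or> y = w"
  "{a, y} \<in> edges GH \<longleftrightarrow> y = v \<or> y = b"
  "{b, y} \<in> edges GH \<longleftrightarrow> y = a \<or> y = c"
  "{c, y} \<in> edges GH \<longleftrightarrow> y = b \<or> y = d"
  "{d, y} \<in> edges GH \<longleftrightarrow> y = c \<or> y = w"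
  "{w, y} \<in> edges GH \<longleftrightarrow> y = d \<or> y = v"
  using new_vertices distinct_hex edge_in_verts
  by (auto simp: edges_H doubleton_eq_iff)

context
  fixes S T
  assumes S: "S \<subseteq> verts G" and T: "T \<subseteq> {a, b, c, d, w}"
begin

lemma mem_union:
  "x \<in> verts G \<Longrightarrow> x \<in> S \<union> T \<longleftrightarrow> x \<in> S"
  "a \<in> S \<union> T \<longleftrightarrow> a \<in> T" "b \<in> S \<union> T \<longleftrightarrow> b \<in> T" "c \<in> S \<union> T \<longleftrightarrow> c \<in> T"
  "d \<in> S \<union> T \<longleftrightarrow> d \<in> T" "w \<in> S \<union> T \<longleftrightarrow> w \<in> T"
  using S T new_vertices by auto

lemma dominated_old:
  assumes "x \<in> verts G" "x \<noteq> v"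
  shows "dominated GH (S \<union> T) x \<longleftrightarrow> dominated G S x"
  unfolding dominated_def edges_old[OF assms] using mem_union(1) edge_in_verts by blast

lemma dominated_new:
  "dominated GH (S \<union> T) v \<longleftrightarrow> dominated G S v \<or> a \<in> T \<or> w \<in> T"
  "dominated GH (S \<union> T) a \<longleftrightarrow> v \<in> S \<or> b \<in> T"
  "dominated GH (S \<union> T) b \<longleftrightarrow> a \<in> T \<or> c \<in> T"
  "dominated GH (S \<union> T) c \<longleftrightarrow> b \<in> T \<or> d \<in> T"
  "dominated GH (S \<union> T) d \<longleftrightarrow> c \<in> T \<or> w \<in> T"
  "dominated GH (S \<union> T) w \<longleftrightarrow> d \<in> T \<or> v \<in> S"
  unfolding dominated_def edges_new
  using mem_union mem_union(1)[OF root_in] edge_in_verts by blast+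

lemma independent_union:
  "independent_set GH (S \<union> T) \<longleftrightarrow> independent_set G S \<and>
     \<not> (v \<in> S \<and> a \<in> T) \<and> \<not> (a \<in> T \<and> b \<in> T) \<and> \<not> (b \<in> T \<and> c \<in> T) \<and>
     \<not> (c \<in> T \<and> d \<in> T) \<and> \<not> (d \<in> T \<and> w \<in> T) \<and> \<not> (w \<in> T \<and> v \<in> S)"
proof -
  have ind: "independent_set K X \<longleftrightarrow> X \<subseteq> verts K \<and> (\<forall>x\<in>X. \<not> dominated K X x)"
    for K :: "'a graph" and X
    unfolding independent_set_def dominated_def by blast
  have sub: "S \<union> T \<subseteq> verts GH"
    using S T by (auto simp: verts_H)
  have "(\<forall>x\<in>S \<union> T. \<not> dominated GH (S \<union> T) x) \<longleftrightarrow>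
      (\<forall>x\<in>S - {v}. \<not> dominated G S x) \<and> (v \<in> S \<longrightarrow> \<not> dominated GH (S \<union> T) v) \<and>
      (\<forall>x\<in>T. \<not> dominated GH (S \<union> T) x)"
    using dominated_old S by blast
  also have "(\<forall>x\<in>T. \<not> dominated GH (S \<union> T) x) \<longleftrightarrow>
      (\<forall>x\<in>{a, b, c, d, w}. x \<in> T \<longrightarrow> \<not> dominated GH (S \<union> T) x)"
    using T by blast
  finally have "(\<forall>x\<in>S \<union> T. \<not> dominated GH (S \<union> T) x) \<longleftrightarrow>
      (\<forall>x\<in>S - {v}. \<not> dominated G S x) \<and> (v \<in> S \<longrightarrow> \<not> dominated GH (S \<union> T) v) \<and>
      (\<forall>x\<in>{a, b, c, d, w}. x \<in> T \<longrightarrow> \<not> dominated GH (S \<union> T) x)" .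
  moreover have "(\<forall>x\<in>S. \<not> dominated G S x) \<longleftrightarrow>
      (\<forall>x\<in>S - {v}. \<not> dominated G S x) \<and> (v \<in> S \<longrightarrow> \<not> dominated G S v)"
    by blast
  ultimately show ?thesis
    unfolding ind ball_simps(5,7) dominated_new using sub S by argo
qed

lemma dominating_except_union:
  "dominating_except GH w (S \<union> T) \<longleftrightarrow>
     dominating_except G v S \<and> (v \<in> S \<or> dominated G S v \<or> a \<in> T \<or> w \<in> T) \<and>
     \<not> (v \<in> S \<and> a \<in> T) \<and> \<not> (a \<in> T \<and> b \<in> T) \<and> \<not> (b \<in> T \<and> c \<in> T) \<and>
     \<not> (c \<in> T \<and> d \<in> T) \<and> \<not> (d \<in> T \<and> w \<in> T) \<and> \<not> (w \<in> T \<and> v \<in> S) \<and>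
     (a \<in> T \<or> v \<in> S \<or> b \<in> T) \<and> (b \<in> T \<or> a \<in> T \<or> c \<in> T) \<and>
     (c \<in> T \<or> b \<in> T \<or> d \<in> T) \<and> (d \<in> T \<or> c \<in> T \<or> w \<in> T)"
proof -
  have "(\<forall>x\<in>verts GH - (S \<union> T) - {w}. dominated GH (S \<union> T) x) \<longleftrightarrow>
      (\<forall>x\<in>verts G - S - {v}. dominated G S x) \<and>
      (\<forall>x\<in>{v, a, b, c, d}. x \<notin> S \<union> T \<longrightarrow> dominated GH (S \<union> T) x)"
  proof -
    have "verts GH - (S \<union> T) - {w} =
        (verts G - S - {v}) \<union> ({v, a, b, c, d} - (S \<union> T))"
      using new_vertices distinct_hex root_in S T by (auto simp: verts_H)
    then show ?thesis
      using dominated_old by (simp only: ball_Un) blast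
  qed
  then show ?thesis
    unfolding dominating_except_def independent_union ball_simps(5,7) dominated_new
      mem_union mem_union(1)[OF root_in]
    by argo
qed

lemma hexagon_part_eqs:
  "T = {a, c, w} \<longleftrightarrow> a \<in> T \<and> b \<notin> T \<and> c \<in> T \<and> d \<notin> T \<and> w \<in> T"
  "T = {b, w} \<longleftrightarrow> a \<notin> T \<and> b \<in> T \<and> c \<notin> T \<and> d \<notin> T \<and> w \<in> T"
  "T = {b, d} \<longleftrightarrow> a \<notin> T \<and> b \<in> T \<and> c \<notin> T \<and> d \<in> T \<and> w \<notin> T"
  "T = {c} \<longleftrightarrow> a \<notin> T \<and> b \<notin> T \<and> c \<in> T \<and> d \<notin> T \<and> w \<notin> T"
  "T = {a, d} \<longleftrightarrow> a \<in> T \<and> b \<notin> T \<and> c \<notin> T \<and> d \<in> T \<and> w \<notin> T"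
  "T = {a, c} \<longleftrightarrow> a \<in> T \<and> b \<notin> T \<and> c \<in> T \<and> d \<notin> T \<and> w \<notin> T"
  using T distinct_hex by auto

lemma containing_sets_union:
  "S \<union> T \<in> containing_sets GH w \<longleftrightarrow>
     (S, T) \<in> (dominating_sets G v \<union> missing_sets G v) \<times> {{a, c, w}, {b, w}}"
  unfolding state_sets_defs mem_Collect_eq Un_iff[of S] mem_Times_iff fst_conv snd_conv
    insert_iff[of T] empty_iff[of T] hexagon_part_eqs dominating_except_union mem_union(6)
  by argo

lemma dominating_sets_union:
  "S \<union> T \<in> dominating_sets GH w \<longleftrightarrow>
     (S, T) \<in> containing_sets G v \<times> {{b, d}, {c}} \<union>
       (dominating_sets G v \<times> {{b, d}, {a, d}} \<union> missing_sets G v \<times> {{a, d}})"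
  unfolding state_sets_defs mem_Collect_eq Un_iff[of "(S, T)"] mem_Times_iff fst_conv snd_conv
    insert_iff[of T] empty_iff[of T] hexagon_part_eqs dominating_except_union mem_union(6)
    dominated_new
  by argo

lemma missing_sets_union:
  "S \<union> T \<in> missing_sets GH w \<longleftrightarrow>
     (S, T) \<in> (dominating_sets G v \<union> missing_sets G v) \<times> {{a, c}}"
  unfolding state_sets_defs mem_Collect_eq Un_iff[of S] mem_Times_iff fst_conv snd_conv
    insert_iff[of T] empty_iff[of T] hexagon_part_eqs dominating_except_union mem_union(6)
    dominated_new
  by argo

end

lemma card_split:
  assumes Z: "Z \<subseteq> Pow (verts GH)" and R: "R \<subseteq> Pow (verts G) \<times> Pow {a, b, c, d, w}"
    and split: "\<And>S T. S \<subseteq> verts G \<Longrightarrow> T \<subseteq> {a, b, c, d, w} \<Longrightarrow> S \<union> T \<in> Z \<longleftrightarrow> (S, T) \<in> R"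
  shows "card Z = card R"
proof -
  have "inj_on (\<lambda>(S, T). S \<union> T) R"
  proof (rule inj_on_inverseI)
    fix p assume "p \<in> R"
    then show "(\<lambda>X. (X \<inter> verts G, X - verts G)) ((\<lambda>(S, T). S \<union> T) p) = p"
      using R new_vertices by (cases p) auto
  qed
  moreover have "(\<lambda>(S, T). S \<union> T) ` R = Z"
  proof (intro equalityI subsetI)
    fix X assume "X \<in> (\<lambda>(S, T). S \<union> T) ` R"
    then obtain S T where "(S, T) \<in> R" "X = S \<union> T" by auto
    then show "X \<in> Z" using split[of S T] R by blast
  next
    fix X assume X: "X \<in> Z"
    have eq: "X = X \<inter> verts G \<union> X \<inter> {a, b, c, d, w}"
      using X Z root_in by (auto simp: verts_H)
    have "(X \<inter> verts G, X \<inter> {a, b, c, d, w}) \<in> R"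
      using split[of "X \<inter> verts G" "X \<inter> {a, b, c, d, w}"] X eq by simp
    then show "X \<in> (\<lambda>(S, T). S \<union> T) ` R"
      using eq by (intro image_eqI[where x = "(X \<inter> verts G, X \<inter> {a, b, c, d, w})"]) simp_all
  qed
  ultimately show ?thesis by (metis card_image)
qed

lemma pattern_neqs: "{a, c, w} \<noteq> {b, w}" "{b, d} \<noteq> {c}" "{b, d} \<noteq> {a, d}"
  using distinct_hex by auto

lemma card_dominating_Un_missing:
  "card (dominating_sets G v \<union> missing_sets G v) =
     card (dominating_sets G v) + card (missing_sets G v)"
  using finite_state_sets[OF rooted]
  by (intro card_Un_disjoint) (auto simp: state_sets_defs)

lemma card_containing_sets_union:
  "card (containing_sets GH w) = 2 * (card (dominating_sets G v) + card (missing_sets G v))"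
proof -
  have "card (containing_sets GH w) =
      card ((dominating_sets G v \<union> missing_sets G v) \<times> {{a, c, w}, {b, w}})"
    by (rule card_split[OF state_sets_subset(1) _ containing_sets_union])
      (use state_sets_subset[of G v] in blast)
  then show ?thesis
    using pattern_neqs by (simp add: card_cartesian_product card_dominating_Un_missing)
qed

lemma card_dominating_sets_union:
  "card (dominating_sets GH w) = 2 * card (containing_sets G v) +
     2 * card (dominating_sets G v) + card (missing_sets G v)"
proof -
  have "card (dominating_sets GH w) =
      card (containing_sets G v \<times> {{b, d}, {c}} \<union>
       (dominating_sets G v \<times> {{b, d}, {a, d}} \<union> missing_sets G v \<times> {{a, d}}))"
    by (rule card_split[OF state_sets_subset(2) _ dominating_sets_union])
      (use state_sets_subset[of G v] in blast)
  also have "\<dots> = card (containing_sets G v \<times> {{b, d}, {c}}) +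
      (card (dominating_sets G v \<times> {{b, d}, {a, d}}) + card (missing_sets G v \<times> {{a, d}}))"
    using finite_state_sets[OF rooted]
    by (subst card_Un_disjoint; (subst card_Un_disjoint)?) (auto simp: state_sets_defs)
  finally show ?thesis
    using pattern_neqs by (simp add: card_cartesian_product)
qed

lemma card_missing_sets_union:
  "card (missing_sets GH w) = card (dominating_sets G v) + card (missing_sets G v)"
proof -
  have "card (missing_sets GH w) =
      card ((dominating_sets G v \<union> missing_sets G v) \<times> {{a, c}})"
    by (rule card_split[OF state_sets_subset(3) _ missing_sets_union])
      (use state_sets_subset[of G v] in blast)
  then show ?thesis
    by (simp add: card_cartesian_product card_dominating_Un_missing)
qed

end

inductive hexagon_chain :: "nat \<Rightarrow> 'a graph \<Rightarrow> 'a \<Rightarrow> bool" where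
  single: "hexagon_chain 0 \<lparr>verts = {v}, edges = {}\<rparr> v"
| attach: "hexagon_chain n G v \<Longrightarrow> hexagon H v a b c d w \<Longrightarrow> verts G \<inter> verts H = {v} \<Longrightarrow>
    hexagon_chain (Suc n) (graph_union G H) w"

fun state_counts :: "nat \<Rightarrow> nat \<times> nat \<times> nat" where
  "state_counts 0 = (1, 0, 1)"
| "state_counts (Suc n) =
    (case state_counts n of (x, y, z) \<Rightarrow> (2 * (y + z), 2 * x + 2 * y + z, y + z))"

lemma hexagon_chain_counts:
  assumes "hexagon_chain n G v"
  shows "rooted_graph G v \<and> (card (containing_sets G v), card (dominating_sets G v),
    card (missing_sets G v)) = state_counts n"
  using assms
proof induction
  case (single v)
  let ?G = "\<lparr>verts = {v}, edges = {}\<rparr>"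
  have "containing_sets ?G v = {{v}}" "dominating_sets ?G v = {}" "missing_sets ?G v = {{}}"
    unfolding state_sets_defs dominating_except_def independent_set_def dominated_def by auto
  then show ?case by (simp add: rooted_graph_def)
next
  case (attach n G v H a b c d w)
  then interpret hexagon_attachment G H v a b c d w
    by unfold_locales auto
  show ?case
    using attach.IH rooted_union card_containing_sets_union card_dominating_sets_union
      card_missing_sets_union
    by (auto split: prod.splits)
qed

lemma ortho_hexagonal_cactus_chain:
  assumes "ortho_hexagonal_cactus n G"
  obtains v where "hexagon_chain n G v"
proof -
  obtain B :: "nat \<Rightarrow> 'a graph" where n: "n \<ge> 1"
    and cyc0: "\<forall>i\<in>{1..n}. cycle_graph 6 (B i)"
    and vG: "verts G = (\<Union>i\<in>{1..n}. verts (B i))"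
    and eG: "edges G = (\<Union>i\<in>{1..n}. edges (B i))"
    and one0: "\<forall>i\<in>{1..n}. i + 1 \<le> n \<longrightarrow> card (verts (B i) \<inter> verts (B (i + 1))) = 1"
    and far0: "\<forall>i\<in>{1..n}. \<forall>j\<in>{1..n}. i + 1 < j \<longrightarrow> verts (B i) \<inter> verts (B j) = {}"
    and adj0: "\<forall>i\<in>{1..n}. 2 \<le> i \<and> i + 1 \<le> n \<longrightarrow>
      (\<forall>u\<in>verts (B (i - 1)) \<inter> verts (B i). \<forall>w\<in>verts (B i) \<inter> verts (B (i + 1)).
        {u, w} \<in> edges G)"
    using assms unfolding ortho_hexagonal_cactus_def by (elim conjE exE)
  have cyc: "cycle_graph 6 (B i)" if "1 \<le> i" "i \<le> n" for i
    using cyc0 that by simp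
  have one: "card (verts (B i) \<inter> verts (B (i + 1))) = 1" if "1 \<le> i" "i < n" for i
    using one0 that by simp
  have far: "verts (B i) \<inter> verts (B j) = {}" if "1 \<le> i" "i + 1 < j" "j \<le> n" for i j
    using far0 that by simp
  have adj: "{u, x} \<in> edges G" if "2 \<le> i" "i < n" "u \<in> verts (B (i - 1)) \<inter> verts (B i)"
    "x \<in> verts (B i) \<inter> verts (B (i + 1))" for i u x
    using adj0[rule_format, of i u x] that by simp
  have ends: "e \<subseteq> verts (B i) \<and> (\<forall>x. e \<noteq> {x})" if i: "1 \<le> i" "i \<le> n" "e \<in> edges (B i)" for i e
  proof -
    obtain v a b c d w where "hexagon (B i) v a b c d w"
      using cyc[OF i(1,2)] by (rule cycle_graph_6_hexagon)
    then show ?thesis using i(3) unfolding hexagon_def by auto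
  qed
  have adj': "{u, x} \<in> edges (B i)"
    if i: "2 \<le> i" "i < n" and u: "u \<in> verts (B (i - 1)) \<inter> verts (B i)"
      and x: "x \<in> verts (B i) \<inter> verts (B (i + 1))" for i u x
  proof -
    obtain j where j: "1 \<le> j" "j \<le> n" "{u, x} \<in> edges (B j)"
      using adj[OF i u x] unfolding eG by auto
    have ux: "u \<in> verts (B j)" "x \<in> verts (B j)"
      using ends[OF j] by auto
    have "verts (B (i - 1)) \<inter> verts (B (i + 1)) = {}"
      using i by (intro far) linarith+
    then have "u \<notin> verts (B (i + 1))" "x \<notin> verts (B (i - 1))"
      using u x by blast+
    moreover consider "j + 1 < i" | "j = i - 1" | "j = i" | "j = i + 1" | "i + 1 < j" by linarith
    ultimately have "j = i"
      using ux far[of j i] far[of i j] u x i j by cases auto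
    then show ?thesis using j by blast
  qed
  define P where "P k = \<lparr>verts = (\<Union>i\<in>{1..k}. verts (B i)), edges = (\<Union>i\<in>{1..k}. edges (B i))\<rparr>"
    for k
  have P_Suc: "P (Suc k) = graph_union (P k) (B (Suc k))" for k
    unfolding P_def graph_union_def by (simp add: atLeastAtMostSuc_conv Un_commute)
  have chain: "hexagon_chain k (P k) z"
    if "1 \<le> k" "k \<le> n" "z \<in> verts (B k)"
      "\<And>u. 2 \<le> k \<Longrightarrow> u \<in> verts (B (k - 1)) \<inter> verts (B k) \<Longrightarrow> {u, z} \<in> edges (B k)" for k z
    using that
  proof (induction k arbitrary: z rule: nat_induct_at_least)
    case base
    obtain u where u: "u \<in> verts (B 1)" "{z, u} \<in> edges (B 1)"
      using cyc[of 1] n base by (metis cycle_graph_6_neighbour order_refl)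
    then obtain a b c d where H: "hexagon (B 1) u a b c d z"
      using cyc[of 1] n by (metis cycle_graph_6_closing_edge insert_commute order_refl)
    have "hexagon_chain (Suc 0) (graph_union \<lparr>verts = {u}, edges = {}\<rparr> (B 1)) z"
      using u H by (intro hexagon_chain.attach[OF hexagon_chain.single]) auto
    moreover have "graph_union \<lparr>verts = {u}, edges = {}\<rparr> (B 1) = P 1"
      using u unfolding graph_union_def P_def by auto
    ultimately show ?case by simp
  next
    case (Suc k)
    obtain u where u: "verts (B k) \<inter> verts (B (k + 1)) = {u}"
      using one[of k] Suc by (auto simp: card_1_singleton_iff)
    have "hexagon_chain k (P k) u"
      using Suc.IH[of u] adj'[of k _ u] u Suc.prems by auto
    moreover have "{u, z} \<in> edges (B (Suc k))"
      using Suc.prems(3)[of u] Suc.hyps u by auto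
    then obtain a b c d where "hexagon (B (Suc k)) u a b c d z"
      using cyc[of "Suc k"] Suc.prems(1) by (metis cycle_graph_6_closing_edge le_add1 plus_1_eq_Suc)
    moreover have "verts (P k) \<inter> verts (B (Suc k)) = {u}"
    proof -
      have "verts (B i) \<inter> verts (B (Suc k)) = {}" if "i \<in> {1..k}" "i \<noteq> k" for i
        using far[of i "Suc k"] that Suc.prems(1) by auto
      then show ?thesis
        using u Suc.hyps unfolding P_def by fastforce
    qed
    ultimately show ?case
      unfolding P_Suc by (rule hexagon_chain.attach)
  qed
  have "\<exists>z \<in> verts (B n). \<forall>u. 2 \<le> n \<longrightarrow> u \<in> verts (B (n - 1)) \<inter> verts (B n) \<longrightarrow>
    {u, z} \<in> edges (B n)"
  proof (cases "2 \<le> n")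
    case True
    then have "1 \<le> n - 1" "n - 1 < n" "n - 1 + 1 = n" by linarith+
    then obtain u where u: "verts (B (n - 1)) \<inter> verts (B n) = {u}"
      using one[of "n - 1"] by (metis card_1_singletonE)
    then obtain z where "z \<in> verts (B n)" "{u, z} \<in> edges (B n)"
      using cyc[of n] n by (metis IntD2 cycle_graph_6_neighbour insertI1 order_refl)
    then show ?thesis using u by auto
  next
    case False
    obtain v a b c d w where "hexagon (B n) v a b c d w"
      using cyc[of n] n by (metis cycle_graph_6_hexagon order_refl)
    then show ?thesis using False unfolding hexagon_def by auto
  qed
  then obtain z where "hexagon_chain n (P n) z"
    using chain[of n] n by blast
  moreover have "P n = G"
    unfolding P_def using vG eG by simp
  ultimately show ?thesis using that by blast
qed

lemma card_maximal_independent_sets_cactus: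
  assumes "ortho_hexagonal_cactus n G"
  shows "card {S. maximal_independent_set G S} =
    (case state_counts n of (x, y, z) \<Rightarrow> x + y)"
proof -
  obtain v where "hexagon_chain n G v"
    using assms by (rule ortho_hexagonal_cactus_chain)
  note counts = hexagon_chain_counts[OF this]
  then show ?thesis
    using card_maximal_independent_sets[of G v] by (auto simp flip: counts[THEN conjunct2])
qed

theorem theorem2p22:
  fixes Q :: "nat \<Rightarrow> 'a graph" and q :: "nat \<Rightarrow> nat"
  assumes "\<And>n. n \<ge> 1 \<Longrightarrow> ortho_hexagonal_cactus n (Q n)"
    and "\<And>n. n \<ge> 1 \<Longrightarrow> q n = card {S. maximal_independent_set (Q n) S}"
  shows "q 1 = 5 \<and> q 2 = 19 \<and> q 3 = 72 \<and>
    (\<forall>n\<ge>4. q n = 3 * q (n - 1) + 3 * q (n - 2))"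
proof -
  have q: "q n = (case state_counts n of (x, y, z) \<Rightarrow> x + y)" if "n \<ge> 1" for n
    using assms card_maximal_independent_sets_cactus that by metis
  have "q n = 3 * q (n - 1) + 3 * q (n - 2)" if "n \<ge> 4" for n
  proof -
    define m where "m = n - 3"
    then have m: "n = Suc (Suc (Suc m))"
      using that by simp
    obtain x y z where "state_counts m = (x, y, z)" by (cases "state_counts m")
    then show ?thesis unfolding m by (simp add: q)
  qed
  moreover have "q 1 = 5" "q 2 = 19" "q 3 = 72"
    by (simp_all add: q numeral_2_eq_2 numeral_3_eq_3)
  ultimately show ?thesis by blast
qed

end
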